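(* Assume the standing assumptions below and let $X_*$ be the unique symmetric positive semidefinite solution of $\mathscr R(X)=0$, where $$\mathscr R(X)=A^{\mathsf T}X+XA+Q+\Pi_{11}(X)-[XB+L+\Pi_{12}(X)][R+\Pi_{22}(X)]^{-1}[XB+L+\Pi_{12}(X)]^{\mathsf T}.$$ Let $X_0$ be symmetric with $X_0\succeq X_*$, $A_{\mathrm c}(X_0)-G_{\mathrm c}(X_0)X_0$ stable, and $\mathscr R(X_0)\preceq0$, and for $k\ge0$ let $X_{k+1}$ be the stabilizing solution of the CARE $A_k^{\mathsf T}X+XA_k-XG_kX+H_k=0$ with $A_k=A_{\mathrm c}(X_k)$, $G_k=G_{\mathrm c}(X_k)$, $H_k=H_{\mathrm c}(X_k)$. Then: (i) $X_0\succeq X_1\succeq\cdots\succeq X_k\succeq X_*$ and $\mathscr R(X_k)\preceq0$ for each $k\ge0$; (ii) $\lim_{k\to\infty}X_k=X_*$.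
   Context: Data: $A,Q\in\mathbb{R}^{n\times n}$, $B,L\in\mathbb{R}^{n\times m}$, $R\in\mathbb{R}^{m\times m}$, $A_0^i\in\mathbb{R}^{n\times n}$, $B_0^i\in\mathbb{R}^{n\times m}$ ($i=1,\dots,r$); $A_0^0=A$, $B_0^0=B$. For symmetric $X$: $\Pi_{11}(X)=\sum_{i=1}^r (A_0^i)^{\mathsf T}XA_0^i$, $\Pi_{12}(X)=\sum_i (A_0^i)^{\mathsf T}XB_0^i$, $\Pi_{22}(X)=\sum_i (B_0^i)^{\mathsf T}XB_0^i$; $L_{\mathrm c}=L+\Pi_{12}$, $R_{\mathrm c}=R+\Pi_{22}$, $Q_{\mathrm c}=Q+\Pi_{11}$; $A_{\mathrm c}(X)=A-BR_{\mathrm c}(X)^{-1}L_{\mathrm c}(X)^{\mathsf T}$, $G_{\mathrm c}(X)=BR_{\mathrm c}(X)^{-1}B^{\mathsf T}$, $H_{\mathrm c}(X)=Q_{\mathrm c}(X)-L_{\mathrm c}(X)R_{\mathrm c}(X)^{-1}L_{\mathrm c}(X)^{\mathsf T}$. A matrix is stable if all its eigenvalues lie in the open left half-plane; a stabilizing solution of a CARE $\mathcal A^{\mathsf T}X+X\mathcal A-X\mathcal GX+\mathcal H=0$ is a symmetric solution with $\mathcal A-\mathcal GX$ stable. Standing assumptions: (1) $R\succ0$, $\begin{bmatrix}Q&L\\L^{\mathsf T}&R\end{bmatrix}\succeq0$; (2) there is $F\in\mathbb{R}^{m\times n}$ with $\dot S=(A+BF)S+S(A+BF)^{\mathsf T}+\sum_{i=1}^r(A_0^i+B_0^iF)S(A_0^i+B_0^iF)^{\mathsf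 T}$ exponentially stable; (3) with $C^{\mathsf T}C=Q-LR^{-1}L^{\mathsf T}$, $C\in\mathbb{R}^{p\times n}$, and $\widetilde A_0^i=A_0^i-B_0^iR^{-1}L^{\mathsf T}$, there is $K\in\mathbb{R}^{n\times p}$ with $\dot S=(\widetilde A_0^0+KC)S+S(\widetilde A_0^0+KC)^{\mathsf T}+\sum_{i=1}^r\widetilde A_0^iS(\widetilde A_0^i)^{\mathsf T}$ exponentially stable; (4) $\mathcal N(Q-LR^{-1}L^{\mathsf T})\subseteq\mathcal N(L^{\mathsf T})\cap\bigcap_i\mathcal N(A_0^i)$; (5) $(A,B)$ stabilizable and $(Q-LR^{-1}L^{\mathsf T},A)$ detectable. Under (1)–(3), $\mathscr R(X)=0$ has a unique positive semidefinite solution $X_*$, which is stabilizing. *)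

theory Defs
  imports "HOL-Analysis.Analysis"
begin

text \<open>Matrices: real^'c^'r is an r-by-c matrix. State dimension 'n, input dimension 'm.
  The multiplicative noise matrices are indexed by i = 1..r via functions A0, B0.\<close>

definition sym_mat :: "real^'n^'n \<Rightarrow> bool" where
  "sym_mat M \<longleftrightarrow> transpose M = M"

definition psd :: "real^'n^'n \<Rightarrow> bool" where
  "psd M \<longleftrightarrow> (\<forall>x. 0 \<le> x \<bullet> (M *v x))"

definition pd :: "real^'n^'n \<Rightarrow> bool" where
  "pd M \<longleftrightarrow> (\<forall>x. x \<noteq> 0 \<longrightarrow> 0 < x \<bullet> (M *v x))"

definition loewner_ge :: "real^'n^'n \<Rightarrow> real^'n^'n \<Rightarrow> bool" where
  "loewner_ge M N \<longleftrightarrow> psd (M - N)"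

definition stable :: "real^'n^'n \<Rightarrow> bool" where
  "stable M \<longleftrightarrow> (\<forall>mu::complex. (\<exists>v::complex^'n. v \<noteq> 0 \<and>
      (\<chi> i j. complex_of_real (M $ i $ j)) *v v = mu *s v) \<longrightarrow> Re mu < 0)"

definition exp_stable :: "(real^'n^'n \<Rightarrow> real^'n^'n) \<Rightarrow> bool" where
  "exp_stable Lop \<longleftrightarrow> (\<exists>c \<alpha>. 0 < \<alpha> \<and> (\<forall>S. (\<forall>t\<ge>0. (S has_vector_derivative Lop (S t)) (at t within {0..}))
      \<longrightarrow> (\<forall>t\<ge>0. norm (S t) \<le> c * exp (- \<alpha> * t) * norm (S 0))))"

definition Pi11 :: "nat \<Rightarrow> (nat \<Rightarrow> real^'n^'n) \<Rightarrow> real^'n^'n \<Rightarrow> real^'n^'n" where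
  "Pi11 r A0 X = (\<Sum>i=1..r. transpose (A0 i) ** X ** A0 i)"

definition Pi12 :: "nat \<Rightarrow> (nat \<Rightarrow> real^'n^'n) \<Rightarrow> (nat \<Rightarrow> real^'m^'n) \<Rightarrow> real^'n^'n \<Rightarrow> real^'m^'n" where
  "Pi12 r A0 B0 X = (\<Sum>i=1..r. transpose (A0 i) ** X ** B0 i)"

definition Pi22 :: "nat \<Rightarrow> (nat \<Rightarrow> real^'m^'n) \<Rightarrow> real^'n^'n \<Rightarrow> real^'m^'m" where
  "Pi22 r B0 X = (\<Sum>i=1..r. transpose (B0 i) ** X ** B0 i)"

definition Lc where "Lc L r A0 B0 X = L + Pi12 r A0 B0 X"
definition Rc where "Rc R r B0 X = R + Pi22 r B0 X"
definition Qc where "Qc Q r A0 X = Q + Pi11 r A0 X"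

definition Ac where
  "Ac A B L R r A0 B0 X = A - B ** matrix_inv (Rc R r B0 X) ** transpose (Lc L r A0 B0 X)"
definition Gc where
  "Gc B R r B0 X = B ** matrix_inv (Rc R r B0 X) ** transpose B"
definition Hc where
  "Hc Q L R r A0 B0 X = Qc Q r A0 X - Lc L r A0 B0 X ** matrix_inv (Rc R r B0 X) ** transpose (Lc L r A0 B0 X)"

definition Ric :: "real^'n^'n \<Rightarrow> real^'m^'n \<Rightarrow> real^'n^'n \<Rightarrow> real^'m^'n \<Rightarrow> real^'m^'m
    \<Rightarrow> nat \<Rightarrow> (nat \<Rightarrow> real^'n^'n) \<Rightarrow> (nat \<Rightarrow> real^'m^'n) \<Rightarrow> real^'n^'n \<Rightarrow> real^'n^'n" where
  "Ric A B Q L R r A0 B0 X =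
     transpose A ** X + X ** A + Q + Pi11 r A0 X
     - (X ** B + L + Pi12 r A0 B0 X) ** matrix_inv (R + Pi22 r B0 X) ** transpose (X ** B + L + Pi12 r A0 B0 X)"

end

theory Submission
  imports Defs "HOL-Computational_Algebra.Fundamental_Theorem_Algebra"
begin

text \<open>
  Let \<open>residual X Y\<close> be the left-hand side at \<open>Y\<close> of the CARE whose coefficients are evaluated at \<open>X\<close>,
  so that the Riccati operator is \<open>residual X X\<close>. Completing the square shows that its quadratic
  form at \<open>x\<close> is the minimum over \<open>u\<close> of a function that is affine in \<open>Y\<close> and monotone in \<open>X\<close>.
  Inserting the minimizer belonging to one argument into the function belonging to another
  turns each comparison of iterates into a Lyapunov inequality
  \<open>M\<^sup>T D + D M \<preceq> 0\<close> with \<open>M\<close> stable, hence \<open>D \<succeq> 0\<close>. The closed-loop matrix at \<open>X\<^sub>k\<^sub>+\<^sub>1\<close> is again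
  stable: an eigenvector for an eigenvalue with nonnegative real part would have zero stage cost,
  and by the kernel condition it would be an unobservable mode of \<open>A\<close>, against detectability.
  The decreasing sequence has a limit, which is a positive semidefinite solution, hence \<open>X\<^sub>*\<close>.
\<close>

section \<open>Eigenvectors in invariant subspaces\<close>

definition poly_orbit :: "(complex^'n \<Rightarrow> complex^'n) \<Rightarrow> complex^'n \<Rightarrow> complex poly \<Rightarrow> complex^'n" where
  "poly_orbit T v p = (\<Sum>i\<le>degree p. coeff p i *s (T ^^ i) v)"

lemma poly_orbit_eq_sum:
  assumes "degree p \<le> N"
  shows "poly_orbit T v p = (\<Sum>i\<le>N. coeff p i *s (T ^^ i) v)"
  unfolding poly_orbit_def
  by (rule sum.mono_neutral_left) (use assms in \<open>auto simp: coeff_eq_0\<close>)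

lemma poly_orbit_linear_factor:
  fixes T :: "complex^'n \<Rightarrow> complex^'n"
  assumes add: "\<And>x y. T (x + y) = T x + T y" and scale: "\<And>c x. T (c *s x) = c *s T x"
  shows "poly_orbit T v ([:- \<mu>, 1:] * q) = T (poly_orbit T v q) - \<mu> *s poly_orbit T v q"
proof -
  have T0: "T 0 = 0" using scale[of 0 0] by simp
  have Tsum: "T (\<Sum>i\<in>I. f i) = (\<Sum>i\<in>I. T (f i))" for I and f :: "nat \<Rightarrow> complex^'n"
    by (induction I rule: infinite_finite_induct) (simp_all add: T0 add)
  define N where "N = degree q"
  have deg: "degree ([:- \<mu>, 1:] * q) \<le> Suc N"
    unfolding N_def by (rule order.trans[OF degree_mult_le]) simp
  have top: "coeff q (Suc N) = 0" by (simp add: N_def coeff_eq_0)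
  have "poly_orbit T v ([:- \<mu>, 1:] * q) = (\<Sum>i\<le>Suc N. coeff (pCons 0 q) i *s (T ^^ i) v)
      - (\<Sum>i\<le>Suc N. (\<mu> * coeff q i) *s (T ^^ i) v)"
    unfolding poly_orbit_eq_sum[OF deg] sum_subtractf[symmetric]
    by (rule sum.cong) (auto simp: vector_sub_rdistrib algebra_simps)
  also have "(\<Sum>i\<le>Suc N. coeff (pCons 0 q) i *s (T ^^ i) v) = T (poly_orbit T v q)"
    unfolding poly_orbit_def N_def[symmetric] Tsum sum.atMost_Suc_shift by (simp add: scale)
  also have "(\<Sum>i\<le>Suc N. (\<mu> * coeff q i) *s (T ^^ i) v) = \<mu> *s poly_orbit T v q"
    by (simp add: poly_orbit_def N_def[symmetric] top vec.scale_sum_right vector_smult_assoc)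
  finally show ?thesis .
qed

lemma annihilating_poly_exists:
  fixes T :: "complex^'n \<Rightarrow> complex^'n"
  obtains p where "p \<noteq> 0" "poly_orbit T v p = 0"
proof (cases "inj (\<lambda>i. (T ^^ i) v)")
  case True
  define f where "f = (\<lambda>i. (T ^^ i) v)"
  define N where "N = DIM(complex^'n)"
  have injf: "inj_on f {..N}" using True unfolding f_def by (rule inj_on_subset) simp
  have "card (f ` {..N}) > DIM(complex^'n)"
    using card_image[OF injf] by (simp add: N_def)
  then have "dependent (f ` {..N})"
    using dependent_biggerset[of "f ` {..N}"] by simp
  then obtain u where u: "\<exists>x\<in>f ` {..N}. u x \<noteq> 0" "(\<Sum>x\<in>f ` {..N}. u x *\<^sub>R x) = 0"
    by (auto simp: dependent_finite)
  define p where "p = (\<Sum>i\<le>N. monom (complex_of_real (u (f i))) i)"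
  have coeff_p: "coeff p i = (if i \<le> N then complex_of_real (u (f i)) else 0)" for i
    unfolding p_def by (simp add: coeff_sum)
  have "degree p \<le> N" by (rule degree_le) (simp add: coeff_p)
  then have "poly_orbit T v p = (\<Sum>i\<le>N. u (f i) *\<^sub>R f i)"
    unfolding poly_orbit_eq_sum[OF \<open>degree p \<le> N\<close>]
    by (intro sum.cong) (auto simp: coeff_p f_def vec_eq_iff scaleR_conv_of_real[where 'a = complex])
  also have "\<dots> = 0" using u(2) by (simp add: sum.reindex[OF injf])
  finally have "poly_orbit T v p = 0" .
  moreover have "p \<noteq> 0"
    using u(1) coeff_p by (metis atMost_iff coeff_0 imageE of_real_eq_0_iff)
  ultimately show ?thesis using that by blast
next
  case False
  then obtain i j where ij: "i < j" "(T ^^ i) v = (T ^^ j) v"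
    unfolding inj_def by (metis linorder_neqE_nat)
  define p where "p = monom (1::complex) j - monom 1 i"
  have "degree p \<le> j" by (rule degree_le) (use ij in \<open>simp add: p_def\<close>)
  then have "poly_orbit T v p = (\<Sum>k\<le>j. coeff p k *s (T ^^ k) v)" by (rule poly_orbit_eq_sum)
  also have "\<dots> = (\<Sum>k\<le>j. (if k = j then (T ^^ k) v else 0) - (if k = i then (T ^^ k) v else 0))"
    by (rule sum.cong) (auto simp: p_def)
  also have "\<dots> = 0" using ij by (simp add: sum_subtractf)
  finally have "poly_orbit T v p = 0" .
  moreover have "coeff p j \<noteq> 0" using ij by (simp add: p_def)
  then have "p \<noteq> 0" by auto
  ultimately show ?thesis using that by blast
qed

lemma eigenvector_in_invariant_subspace:
  fixes T :: "complex^'n \<Rightarrow> complex^'n"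
  assumes add: "\<And>x y. T (x + y) = T x + T y" and scale: "\<And>c x. T (c *s x) = c *s T x"
    and V: "vec.subspace V" and inv: "\<And>x. x \<in> V \<Longrightarrow> T x \<in> V"
    and v: "v \<in> V" "v \<noteq> 0"
  shows "\<exists>\<mu> w. w \<in> V \<and> w \<noteq> 0 \<and> T w = \<mu> *s w"
proof -
  have "\<exists>\<mu> w. w \<in> V \<and> w \<noteq> 0 \<and> T w = \<mu> *s w" if "p \<noteq> 0" "poly_orbit T v p = 0" for p
    using that
  proof (induction "degree p" arbitrary: p)
    case 0
    then obtain c where "p = [:c:]" by (metis degree_eq_zeroE)
    with 0 v show ?case by (simp add: poly_orbit_def vec.scale_eq_0_iff)
  next
    case (Suc d)
    then obtain \<mu> where "poly p \<mu> = 0"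
      using fundamental_theorem_of_algebra_alt[of p] by (metis degree_pCons_0 nat.distinct(1))
    then obtain q where q: "p = [:- \<mu>, 1:] * q" by (metis dvdE poly_eq_0_iff_dvd)
    have "q \<noteq> 0" using q Suc by auto
    have deg: "d = degree q"
      using Suc.hyps(2) \<open>q \<noteq> 0\<close> unfolding q by (subst (asm) degree_mult_eq) auto
    let ?w = "poly_orbit T v q"
    have "(T ^^ i) v \<in> V" for i by (induction i) (simp_all add: v inv)
    then have "?w \<in> V"
      unfolding poly_orbit_def by (intro vec.subspace_sum V vec.subspace_scale) auto
    moreover have "T ?w = \<mu> *s ?w"
      using Suc.prems(2) poly_orbit_linear_factor[of T v \<mu> q, OF add scale] by (simp add: q)
    ultimately show ?case
      using Suc.hyps(1)[OF deg \<open>q \<noteq> 0\<close>] by blast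
  qed
  then show ?thesis using annihilating_poly_exists by metis
qed

definition cvec :: "real^'n \<Rightarrow> real^'n \<Rightarrow> complex^'n" where
  "cvec a b = (\<chi> i. Complex (a $ i) (b $ i))"

lemma cvec_surj: "\<exists>a b. z = cvec a b"
  by (rule exI[of _ "\<chi> i. Re (z $ i)"], rule exI[of _ "\<chi> i. Im (z $ i)"])
    (simp add: cvec_def vec_eq_iff)

lemma cvec_eq_iff: "cvec a b = cvec c d \<longleftrightarrow> a = c \<and> b = d"
  by (auto simp: cvec_def vec_eq_iff)

lemma cvec_0: "cvec 0 0 = 0"
  by (simp add: cvec_def vec_eq_iff complex_eq_iff)

lemma cvec_add: "cvec a b + cvec c d = cvec (a + c) (b + d)"
  by (simp add: cvec_def vec_eq_iff complex_eq_iff)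

lemma cvec_scale: "\<mu> *s cvec a b = cvec (Re \<mu> *\<^sub>R a - Im \<mu> *\<^sub>R b) (Im \<mu> *\<^sub>R a + Re \<mu> *\<^sub>R b)"
  by (simp add: cvec_def vec_eq_iff complex_eq_iff)

lemma of_real_matrix_cvec:
  "(\<chi> i j. complex_of_real (M $ i $ j)) *v cvec a b = cvec (M *v a) (M *v b)"
  by (simp add: cvec_def vec_eq_iff complex_eq_iff matrix_vector_mult_def)

lemma stable_iff_real:
  "stable M \<longleftrightarrow> (\<forall>\<alpha> \<beta> a b. (a \<noteq> 0 \<or> b \<noteq> 0) \<and> M *v a = \<alpha> *\<^sub>R a - \<beta> *\<^sub>R b
      \<and> M *v b = \<beta> *\<^sub>R a + \<alpha> *\<^sub>R b \<longrightarrow> \<alpha> < 0)" (is "_ \<longleftrightarrow> ?R")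
proof
  assume st: "stable M"
  show ?R
  proof (intro allI impI)
    fix \<alpha> \<beta> and a b :: "real^'a"
    assume *: "(a \<noteq> 0 \<or> b \<noteq> 0) \<and> M *v a = \<alpha> *\<^sub>R a - \<beta> *\<^sub>R b \<and> M *v b = \<beta> *\<^sub>R a + \<alpha> *\<^sub>R b"
    then have "cvec a b \<noteq> 0"
      "(\<chi> i j. complex_of_real (M $ i $ j)) *v cvec a b = Complex \<alpha> \<beta> *s cvec a b"
      unfolding of_real_matrix_cvec cvec_scale cvec_0[symmetric] cvec_eq_iff by auto
    then have "Re (Complex \<alpha> \<beta>) < 0" using st unfolding stable_def by blast
    then show "\<alpha> < 0" by simp
  qed
next
  assume R: ?R
  show "stable M"
    unfolding stable_def
  proof (intro allI impI, elim exE conjE)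
    fix \<mu> and v :: "complex^'a"
    assume v: "v \<noteq> 0" "(\<chi> i j. complex_of_real (M $ i $ j)) *v v = \<mu> *s v"
    obtain a b where ab: "v = cvec a b" using cvec_surj by blast
    show "Re \<mu> < 0"
      using R v unfolding ab of_real_matrix_cvec cvec_scale cvec_0[symmetric] cvec_eq_iff by blast
  qed
qed

lemma real_eigenpair_in_invariant_subspace:
  fixes M :: "real^'n^'n"
  assumes U: "subspace U" and inv: "\<And>x. x \<in> U \<Longrightarrow> M *v x \<in> U" and v: "v \<in> U" "v \<noteq> 0"
  obtains \<alpha> \<beta> a b where "a \<in> U" "b \<in> U" "a \<noteq> 0 \<or> b \<noteq> 0"
    "M *v a = \<alpha> *\<^sub>R a - \<beta> *\<^sub>R b" "M *v b = \<beta> *\<^sub>R a + \<alpha> *\<^sub>R b"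
proof -
  let ?T = "\<lambda>z. (\<chi> i j. complex_of_real (M $ i $ j)) *v z"
  define V where "V = {cvec a b | a b. a \<in> U \<and> b \<in> U}"
  have memV: "cvec a b \<in> V \<longleftrightarrow> a \<in> U \<and> b \<in> U" for a b
    unfolding V_def by (auto simp: cvec_eq_iff)
  have "vec.subspace V"
  proof (rule vec.subspaceI)
    show "0 \<in> V" using U by (simp add: memV cvec_0[symmetric] subspace_0)
  next
    fix x y assume "x \<in> V" "y \<in> V"
    then show "x + y \<in> V"
      using cvec_surj[of x] cvec_surj[of y] U by (auto simp: memV cvec_add subspace_add)
  next
    fix c x assume "x \<in> V"
    then show "c *s x \<in> V"
      using cvec_surj[of x] U
      by (auto simp: memV cvec_scale subspace_add subspace_diff subspace_scale)
  qed
  moreover have "?T x \<in> V" if "x \<in> V" for x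
    using that cvec_surj[of x] inv by (auto simp: memV of_real_matrix_cvec)
  moreover have "cvec v 0 \<in> V" "cvec v 0 \<noteq> 0"
    using v U by (auto simp: memV subspace_0 cvec_0[symmetric] cvec_eq_iff)
  ultimately obtain \<mu> w where w: "w \<in> V" "w \<noteq> 0" "?T w = \<mu> *s w"
    using eigenvector_in_invariant_subspace[of ?T V "cvec v 0"]
    by (auto simp: matrix_vector_right_distrib vector_scalar_commute)
  obtain a b where ab: "w = cvec a b" using cvec_surj by blast
  show ?thesis
    using that[of a b "Re \<mu>" "Im \<mu>"] w
    unfolding ab memV of_real_matrix_cvec cvec_scale cvec_0[symmetric] cvec_eq_iff by blast
qed

section \<open>Quadratic forms\<close>

declare transpose_matrix_vector [simp del]

lemma transpose_add: "transpose (X + Y) = transpose X + transpose Y"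
  by (simp add: transpose_def vec_eq_iff)

lemma transpose_diff: "transpose (X - Y) = transpose X - transpose Y"
  by (simp add: transpose_def vec_eq_iff)

lemma matrix_mult_add_left: "(X + Y) ** Z = X ** Z + Y ** Z" for X Y :: "real^'a^'b"
  by (simp add: matrix_matrix_mult_def vec_eq_iff sum.distrib algebra_simps)

lemma matrix_scaleR_left: "(c *\<^sub>R X) ** Y = c *\<^sub>R (X ** Y)" for X :: "real^'a^'b"
  by (simp add: matrix_matrix_mult_def vec_eq_iff sum_distrib_left mult_ac)

lemma matrix_scaleR_right: "X ** (c *\<^sub>R Y) = c *\<^sub>R (X ** Y)" for X :: "real^'a^'b"
  by (simp add: matrix_matrix_mult_def vec_eq_iff sum_distrib_left mult_ac)

lemma matrix_vector_mult_minus_left: "(- X) *v x = - (X *v x)" for X :: "real^'a^'b"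
  by (simp add: matrix_vector_mult_def vec_eq_iff sum_negf)

lemma matrix_vector_mult_minus_right: "X *v (- x) = - (X *v x)" for X :: "real^'a^'b"
  by (simp add: matrix_vector_mult_def vec_eq_iff sum_negf)

lemma inner_transpose_mult: "x \<bullet> (transpose M *v y) = (M *v x) \<bullet> (y :: real^'m)"
  for M :: "real^'n^'m"
  by (metis dot_lmul_matrix inner_commute transpose_matrix_vector)

lemma sym_mat_inner: "sym_mat S \<Longrightarrow> x \<bullet> (S *v y) = (S *v x) \<bullet> y"
  by (metis inner_transpose_mult sym_mat_def)

lemma sym_mat_iff_inner: "sym_mat S \<longleftrightarrow> (\<forall>x y. x \<bullet> (S *v y) = (S *v x) \<bullet> y)"
proof
  assume *: "\<forall>x y. x \<bullet> (S *v y) = (S *v x) \<bullet> y"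
  have "transpose S *v y = S *v y" for y
    by (subst vector_eq_rdot[symmetric]) (metis * inner_transpose_mult inner_commute)
  then show "sym_mat S" unfolding sym_mat_def by (metis matrix_eq)
qed (simp add: sym_mat_inner)

lemma psd_kernel:
  assumes S: "sym_mat S" "psd S" and x: "x \<bullet> (S *v x) = 0"
  shows "S *v x = 0"
proof (rule ccontr)
  assume "S *v x \<noteq> 0"
  define y where "y = S *v x"
  define c where "c = y \<bullet> (S *v y)"
  have y: "y \<bullet> y > 0" using \<open>S *v x \<noteq> 0\<close> by (simp add: y_def)
  have c: "c \<ge> 0" using S(2) by (simp add: c_def psd_def)
  define s where "s = - (y \<bullet> y) / (c + 1)"
  have "x \<bullet> (S *v y) = y \<bullet> y" using S(1) by (simp add: sym_mat_inner y_def)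
  then have "(x + s *\<^sub>R y) \<bullet> (S *v (x + s *\<^sub>R y)) = 2 * s * (y \<bullet> y) + s\<^sup>2 * c"
    using x by (simp add: matrix_vector_right_distrib matrix_vector_mult_scaleR inner_add_left
        inner_add_right y_def[symmetric] c_def algebra_simps power2_eq_square)
  moreover have "0 \<le> (x + s *\<^sub>R y) \<bullet> (S *v (x + s *\<^sub>R y))" using S(2) by (simp add: psd_def)
  moreover have "s * (c + 1) = - (y \<bullet> y)" using c by (simp add: s_def)
  then have "s\<^sup>2 * c = - s * (y \<bullet> y) - s\<^sup>2" by algebra
  moreover have "s * (y \<bullet> y) < 0"
    using c y by (auto simp: s_def intro!: mult_neg_pos divide_neg_pos)
  ultimately show False using zero_le_power2[of s] by linarith
qed

lemma sym_mat_eq_0: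
  assumes "sym_mat S" "\<And>x. x \<bullet> (S *v x) = 0"
  shows "S = 0"
  using psd_kernel[OF assms(1) _ assms(2)] assms(2)
  by (metis matrix_eq matrix_vector_mult_0 order_refl psd_def)

lemma psd_if_loewner_ge: "loewner_ge X Y \<Longrightarrow> psd Y \<Longrightarrow> psd X"
  unfolding loewner_ge_def psd_def
  by (simp add: matrix_vector_mult_diff_rdistrib inner_diff_right) (meson order_trans)

lemma sym_mat_range:
  fixes S :: "real^'n^'n"
  assumes S: "sym_mat S" and v: "\<And>x. S *v x = 0 \<Longrightarrow> x \<bullet> v = 0"
  shows "\<exists>y. v = S *v y"
proof -
  obtain p q where p: "p \<in> span (range ((*v) S))"
    and q: "\<And>w. w \<in> span (range ((*v) S)) \<Longrightarrow> orthogonal q w" and v_eq: "v = p + q"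
    using orthogonal_subspace_decomp_exists[of "range ((*v) S)" v] by metis
  have "subspace (range ((*v) S))"
    by (intro linear_subspace_image subspace_UNIV matrix_vector_mul_linear)
  then have sp: "span (range ((*v) S)) = range ((*v) S)" by (simp add: span_eq_iff)
  have "(S *v q) \<bullet> y = 0" for y
    using q[of "S *v y"] S unfolding sp by (simp add: orthogonal_def sym_mat_inner)
  then have "S *v q = 0" by (metis inner_eq_zero_iff)
  then have "q \<bullet> v = 0" by (rule v)
  moreover have "q \<bullet> p = 0" using q[OF p] by (simp add: orthogonal_def)
  ultimately have "q = 0" by (simp add: v_eq inner_add_right)
  then show ?thesis using p unfolding sp v_eq by auto
qed

lemma pd_rayleigh_min:
  fixes D P :: "real^'n^'n"
  assumes "pd P"
  obtains t x where "x \<noteq> 0" "x \<bullet> (D *v x) = t * (x \<bullet> (P *v x))"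
    "\<And>y. t * (y \<bullet> (P *v y)) \<le> y \<bullet> (D *v y)"
proof -
  define g where "g x = (x \<bullet> (D *v x)) / (x \<bullet> (P *v x))" for x
  have pos: "x \<noteq> 0 \<Longrightarrow> 0 < x \<bullet> (P *v x)" for x using assms by (simp add: pd_def)
  have cont: "continuous_on (sphere 0 1) g"
    unfolding g_def
    using pos
    by (intro continuous_intros linear_continuous_on matrix_vector_mul_bounded_linear)
      (metis less_irrefl norm_zero mem_sphere_0 zero_neq_one)
  obtain x where x: "x \<in> sphere 0 1" "\<And>y. y \<in> sphere 0 1 \<Longrightarrow> g x \<le> g y"
    using continuous_attains_inf[OF compact_sphere _ cont]
    by (metis empty_iff vector_choose_size mem_sphere_0 zero_le_one)
  have "x \<noteq> 0" using x(1) by auto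
  show ?thesis
  proof (rule that[of x "g x"])
    show "x \<noteq> 0" by fact
    then show "x \<bullet> (D *v x) = g x * (x \<bullet> (P *v x))" using pos[of x] by (simp add: g_def)
    fix y
    show "g x * (y \<bullet> (P *v y)) \<le> y \<bullet> (D *v y)"
    proof (cases "y = 0")
      case False
      have "g x \<le> g (y /\<^sub>R norm y)" using False by (intro x(2)) simp
      also have "\<dots> = g y"
        using False by (simp add: g_def matrix_vector_mult_scaleR)
      finally show ?thesis using pos[OF False] by (simp add: g_def field_simps)
    qed simp
  qed
qed

section \<open>Lyapunov's theorem\<close>

definition outer :: "real^'n \<Rightarrow> real^'n \<Rightarrow> real^'n^'n" where
  "outer x y = (\<chi> i j. x $ i * y $ j)"

lemma inner_outer: "S \<bullet> outer x y = x \<bullet> (S *v y)"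
  by (simp add: outer_def inner_vec_def matrix_vector_mult_def sum_distrib_left mult_ac)

lemma outer_mult_vec: "outer x y *v z = (y \<bullet> z) *\<^sub>R x"
  by (simp add: outer_def inner_vec_def matrix_vector_mult_def vec_eq_iff
      sum_distrib_right sum_distrib_left mult_ac)

lemma mult_outer: "M ** outer x y = outer (M *v x) y"
  by (simp add: outer_def matrix_matrix_mult_def matrix_vector_mult_def vec_eq_iff
      sum_distrib_right sum_distrib_left mult_ac)

lemma outer_mult: "outer x y ** M = outer x (transpose M *v y)"
  by (simp add: outer_def matrix_matrix_mult_def matrix_vector_mult_def vec_eq_iff transpose_def
      sum_distrib_left mult_ac)

text \<open>The range of \<open>S\<close> is \<open>M\<close>-invariant, so it would contain an eigenvector of \<open>M\<close>.\<close>
lemma stable_no_dual_certificate: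
  fixes M S :: "real^'n^'n"
  assumes M: "stable M" and S: "sym_mat S" "psd S"
    and MS: "\<And>x. 0 \<le> x \<bullet> (S *v (transpose M *v x))"
  shows "S = 0"
proof (rule ccontr)
  assume "S \<noteq> 0"
  have ker: "S *v (transpose M *v x) = 0" if x: "S *v x = 0" for x
  proof -
    define T where "T = S ** transpose M + M ** S"
    have Tx: "T *v y = S *v (transpose M *v y) + M *v (S *v y)" for y
      by (simp add: T_def matrix_vector_mult_add_rdistrib matrix_vector_mul_assoc)
    have "sym_mat T"
      using S(1) by (simp add: sym_mat_def T_def transpose_add matrix_transpose_mul add.commute)
    moreover have Ty: "y \<bullet> (T *v y) = 2 * (y \<bullet> (S *v (transpose M *v y)))" for y
      unfolding Tx inner_add_right
      using inner_transpose_mult[of "S *v y" M y] sym_mat_inner[OF S(1), of y "transpose M *v y"]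
      by (metis inner_commute mult_2 inner_transpose_mult transpose_transpose)
    then have "psd T" unfolding psd_def using MS by simp
    moreover have "x \<bullet> (T *v x) = 0"
      unfolding Ty sym_mat_inner[OF S(1)] x by simp
    ultimately have "T *v x = 0" by (rule psd_kernel)
    then show ?thesis by (simp add: Tx x)
  qed
  define U where "U = {v. \<forall>x. S *v x = 0 \<longrightarrow> x \<bullet> v = 0}"
  have U: "subspace U"
    unfolding U_def subspace_def by (simp add: inner_add_right)
  have inv: "M *v v \<in> U" if "v \<in> U" for v
    unfolding U_def
  proof (intro CollectI allI impI)
    fix x assume "S *v x = 0"
    then have "(transpose M *v x) \<bullet> v = 0" using that ker unfolding U_def by blast
    then show "x \<bullet> (M *v v) = 0" using inner_transpose_mult[of v M x] by (simp add: inner_commute)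
  qed
  obtain y where y: "S *v y \<noteq> 0" using \<open>S \<noteq> 0\<close> by (metis matrix_eq matrix_vector_mult_0)
  have "S *v y \<in> U" unfolding U_def by (simp add: sym_mat_inner[OF S(1)])
  then obtain \<alpha> \<beta> a b where ab: "a \<in> U" "b \<in> U" "a \<noteq> 0 \<or> b \<noteq> 0"
    "M *v a = \<alpha> *\<^sub>R a - \<beta> *\<^sub>R b" "M *v b = \<beta> *\<^sub>R a + \<alpha> *\<^sub>R b"
    using real_eigenpair_in_invariant_subspace[OF U inv _ y] by metis
  have "\<alpha> < 0" using M ab unfolding stable_iff_real by blast
  obtain p q where p: "a = S *v p" and q: "b = S *v q"
    using ab(1,2) sym_mat_range[OF S(1)] unfolding U_def by blast
  have pq: "p \<bullet> b = q \<bullet> a" unfolding p q by (metis S(1) inner_commute sym_mat_inner)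
  have nn: "0 \<le> p \<bullet> (M *v a)" "0 \<le> q \<bullet> (M *v b)"
    using MS[of p] MS[of q] unfolding sym_mat_inner[OF S(1)] p[symmetric] q[symmetric]
    by (simp_all add: inner_transpose_mult inner_commute)
  have "p \<bullet> (M *v a) + q \<bullet> (M *v b) = \<alpha> * (p \<bullet> a + q \<bullet> b)"
    unfolding ab by (simp add: inner_diff_right inner_add_right pq algebra_simps)
  moreover have "p \<bullet> a + q \<bullet> b > 0"
  proof -
    have "p \<bullet> a \<ge> 0" "q \<bullet> b \<ge> 0" using S(2) by (simp_all add: p q psd_def)
    moreover have "p \<bullet> a \<noteq> 0 \<or> q \<bullet> b \<noteq> 0" using ab(3) psd_kernel[OF S] unfolding p q by blast
    ultimately show ?thesis by linarith
  qed
  ultimately show False using nn \<open>\<alpha> < 0\<close> by (smt (verit) mult_neg_pos)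
qed

text \<open>
  If no such \<open>P\<close> exists, the convex cone of all \<open>M\<^sup>T P + P M + W\<close> (\<open>P\<close>, \<open>W\<close> positive semidefinite)
  misses the negative definite matrices, and the normal \<open>S\<close> of a separating hyperplane is
  positive semidefinite with \<open>M S + S M\<^sup>T \<succeq> 0\<close>. As \<open>W\<close> need not be symmetric, the cone contains
  all skew matrices, which forces \<open>S\<close> to be symmetric.
\<close>
lemma stable_lyapunov_exists:
  fixes M :: "real^'n^'n"
  assumes M: "stable M"
  obtains P where "sym_mat P" "psd P" "pd (- (transpose M ** P + P ** M))"
proof -
  let ?Ly = "\<lambda>P. transpose M ** P + P ** M"
  define N where "N = {Y :: real^'n^'n. pd (- Y)}"
  define C where "C = {?Ly P + W | P W. sym_mat P \<and> psd P \<and> psd W}"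
  have CI: "?Ly P + W \<in> C" if "sym_mat P" "psd P" "psd W" for P W
    using that unfolding C_def by blast
  have Ly_add: "?Ly (P + P') = ?Ly P + ?Ly P'" for P P'
    by (simp add: matrix_add_ldistrib matrix_mult_add_left)
  have Ly_scale: "?Ly (c *\<^sub>R P) = c *\<^sub>R ?Ly P" for c P
    by (simp add: matrix_scaleR_left matrix_scaleR_right scaleR_add_right)
  have psd_add: "psd (X + Y)" if "psd X" "psd Y" for X Y :: "real^'n^'n"
    using that by (simp add: psd_def matrix_vector_mult_add_rdistrib inner_add_right)
  have psd_scale: "psd (c *\<^sub>R X)" if "psd X" "0 \<le> c" for X :: "real^'n^'n" and c
    using that by (simp add: psd_def scaleR_matrix_vector_assoc[symmetric])
  have C_scale: "c *\<^sub>R Y \<in> C" if Y: "Y \<in> C" and c: "0 \<le> c" for c Y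
  proof -
    obtain P W where "sym_mat P" "psd P" "psd W" "Y = ?Ly P + W" using Y unfolding C_def by blast
    then have "c *\<^sub>R Y = ?Ly (c *\<^sub>R P) + c *\<^sub>R W" by (simp only: Ly_scale scaleR_add_right)
    moreover have "sym_mat (c *\<^sub>R P)"
      using \<open>sym_mat P\<close> by (simp add: sym_mat_def transpose_scalar)
    ultimately show ?thesis
      using CI psd_scale[OF \<open>psd P\<close> c] psd_scale[OF \<open>psd W\<close> c] by simp
  qed
  have C_add: "Y + Z \<in> C" if YZ: "Y \<in> C" "Z \<in> C" for Y Z
  proof -
    obtain P W P' W' where "sym_mat P" "psd P" "psd W" "Y = ?Ly P + W"
      "sym_mat P'" "psd P'" "psd W'" "Z = ?Ly P' + W'" using YZ unfolding C_def by blast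
    moreover from this have "Y + Z = ?Ly (P + P') + (W + W')"
      unfolding Ly_add by (simp only: ac_simps)
    moreover have "sym_mat (P + P')"
      using \<open>sym_mat P\<close> \<open>sym_mat P'\<close> by (simp add: sym_mat_def transpose_add)
    ultimately show ?thesis using CI psd_add by metis
  qed
  have zeros: "sym_mat (0 :: real^'n^'n)" "psd (0 :: real^'n^'n)"
    by (simp_all add: psd_def sym_mat_def transpose_def vec_eq_iff)
  have "convex C" by (intro convexI C_add C_scale)
  moreover have "convex N"
  proof (rule convexI)
    fix X Y :: "real^'n^'n" and u v :: real
    assume XY: "X \<in> N" "Y \<in> N" and uv: "0 \<le> u" "0 \<le> v" "u + v = 1"
    show "u *\<^sub>R X + v *\<^sub>R Y \<in> N"
      unfolding N_def mem_Collect_eq pd_def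
    proof (intro allI impI)
      fix x :: "real^'n" assume "x \<noteq> 0"
      then have neg: "x \<bullet> (X *v x) < 0" "x \<bullet> (Y *v x) < 0"
        using XY by (auto simp: N_def pd_def matrix_vector_mult_minus_left)
      have "u * (x \<bullet> (X *v x)) + v * (x \<bullet> (Y *v x)) < 0"
        using neg uv by (smt (verit) mult_nonneg_nonpos mult_pos_neg)
      then show "0 < x \<bullet> (- (u *\<^sub>R X + v *\<^sub>R Y) *v x)"
        unfolding matrix_vector_mult_minus_left matrix_vector_mult_add_rdistrib
          scaleR_matrix_vector_assoc[symmetric] by (simp add: inner_diff_right)
    qed
  qed
  moreover have "- mat 1 \<in> N" by (simp add: N_def pd_def)
  moreover have "0 \<in> C" using CI[OF zeros zeros(2)] by simp
  moreover have "N \<inter> C \<noteq> {}"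
  proof
    assume "N \<inter> C = {}"
    then obtain S b where S: "S \<noteq> 0" and b: "\<forall>Y\<in>C. b \<le> S \<bullet> Y"
      using separating_hyperplane_sets[OF \<open>convex N\<close> \<open>convex C\<close>]
        \<open>- mat 1 \<in> N\<close> \<open>0 \<in> C\<close> by blast
    have nonneg: "0 \<le> S \<bullet> Y" if "Y \<in> C" for Y
    proof (rule ccontr)
      assume neg: "\<not> 0 \<le> S \<bullet> Y"
      define c where "c = (\<bar>b\<bar> + 1) / - (S \<bullet> Y)"
      have "0 \<le> c" using neg by (simp add: c_def divide_nonneg_neg)
      then have "b \<le> c * (S \<bullet> Y)" using b C_scale[OF that] by (metis inner_scaleR_right)
      also have "\<dots> = - (\<bar>b\<bar> + 1)" using neg by (simp add: c_def)
      finally show False by linarith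
    qed
    have W: "0 \<le> S \<bullet> W" if "psd W" for W
      using nonneg[OF CI[OF zeros that]] by simp
    have Ly: "0 \<le> S \<bullet> ?Ly P" if "sym_mat P" "psd P" for P
      using nonneg[OF CI[OF that zeros(2)]] by simp
    have "x \<bullet> (S *v y) \<le> y \<bullet> (S *v x)" for x y
      using W[of "outer y x - outer x y"]
      by (simp add: psd_def matrix_vector_mult_diff_rdistrib outer_mult_vec inner_diff_right
          inner_outer inner_commute)
    then have symS: "sym_mat S"
      unfolding sym_mat_iff_inner by (metis antisym inner_commute)
    have psd_outer: "psd (outer x x)" for x :: "real^'n"
      by (simp add: psd_def outer_mult_vec inner_commute)
    have psdS: "psd S"
      using W[OF psd_outer] by (simp add: psd_def[of S] inner_outer)
    have "0 \<le> x \<bullet> (S *v (transpose M *v x))" for x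
    proof -
      have "sym_mat (outer x x)" by (simp add: sym_mat_def outer_def transpose_def mult.commute)
      then have "0 \<le> S \<bullet> ?Ly (outer x x)" using psd_outer by (rule Ly)
      then have "0 \<le> (transpose M *v x) \<bullet> (S *v x) + x \<bullet> (S *v (transpose M *v x))"
        by (simp only: mult_outer outer_mult inner_add_right inner_outer)
      also have "(transpose M *v x) \<bullet> (S *v x) = x \<bullet> (S *v (transpose M *v x))"
        using symS by (metis inner_commute sym_mat_inner)
      finally show ?thesis by simp
    qed
    then have "S = 0" by (rule stable_no_dual_certificate[OF M symS psdS])
    then show False using S by simp
  qed
  ultimately obtain P W where P: "sym_mat P" "psd P" "psd W" "pd (- (?Ly P + W))"
    unfolding N_def C_def by blast
  have "pd (- ?Ly P)"
    unfolding pd_def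
  proof (intro allI impI)
    fix x :: "real^'n" assume "x \<noteq> 0"
    then have "0 < x \<bullet> (- (?Ly P + W) *v x)" using P(4) by (simp add: pd_def)
    also have "\<dots> = x \<bullet> (- ?Ly P *v x) - x \<bullet> (W *v x)"
      by (simp only: minus_add_distrib matrix_vector_mult_add_rdistrib inner_add_right
          matrix_vector_mult_minus_left inner_minus_right)
    also have "\<dots> \<le> x \<bullet> (- ?Ly P *v x)" using P(3) by (simp add: psd_def)
    finally show "0 < x \<bullet> (- ?Ly P *v x)" .
  qed
  then show ?thesis using that P by blast
qed

lemma lyapunov_form:
  assumes "sym_mat P"
  shows "x \<bullet> ((transpose M ** P + P ** M) *v x) = 2 * ((P *v x) \<bullet> (M *v x))"
proof -
  have "x \<bullet> ((transpose M ** P) *v x) = (P *v x) \<bullet> (M *v x)"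
    by (simp add: matrix_vector_mul_assoc[symmetric] inner_transpose_mult inner_commute
       )
  moreover have "x \<bullet> ((P ** M) *v x) = (P *v x) \<bullet> (M *v x)"
    using assms by (simp add: matrix_vector_mul_assoc[symmetric] sym_mat_inner)
  ultimately show ?thesis by (simp add: matrix_vector_mult_add_rdistrib inner_add_right)
qed

lemma lyapunov_comparison:
  fixes M D :: "real^'n^'n"
  assumes M: "stable M" and D: "sym_mat D" and le: "\<And>x. (D *v x) \<bullet> (M *v x) \<le> 0"
  shows "psd D"
proof -
  obtain P where P: "sym_mat P" "psd P" "pd (- (transpose M ** P + P ** M))"
    using stable_lyapunov_exists[OF M] .
  have neg: "(P *v x) \<bullet> (M *v x) < 0" if "x \<noteq> 0" for x
    using P(3)[unfolded pd_def matrix_vector_mult_minus_left inner_minus_right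
        lyapunov_form[OF P(1)]] that by fastforce
  have "pd P"
    unfolding pd_def using P(2) psd_kernel[OF P(1,2)] neg
    by (metis inner_zero_left less_eq_real_def order_less_irrefl psd_def)
  then obtain t x where x: "x \<noteq> 0" "x \<bullet> (D *v x) = t * (x \<bullet> (P *v x))"
    and t: "\<And>y. t * (y \<bullet> (P *v y)) \<le> y \<bullet> (D *v y)"
    using pd_rayleigh_min[of P D] by blast
  define E where "E = D - t *\<^sub>R P"
  have E: "E *v y = D *v y - t *\<^sub>R (P *v y)" for y
    by (simp add: E_def matrix_vector_mult_diff_rdistrib scaleR_matrix_vector_assoc)
  have "sym_mat E" unfolding sym_mat_iff_inner E
    by (simp add: inner_diff_left inner_diff_right sym_mat_inner[OF D] sym_mat_inner[OF P(1)])
  moreover have "psd E" unfolding psd_def E by (simp add: inner_diff_right t)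
  moreover have "x \<bullet> (E *v x) = 0" unfolding E by (simp add: inner_diff_right x(2))
  ultimately have "E *v x = 0" by (rule psd_kernel)
  then have "D *v x = t *\<^sub>R (P *v x)" by (simp add: E)
  then have "t * ((P *v x) \<bullet> (M *v x)) \<le> 0" using le[of x] by simp
  then have "0 \<le> t" using neg[OF x(1)] by (simp add: mult_le_0_iff)
  then show ?thesis
    unfolding psd_def using t P(2) by (meson mult_nonneg_nonneg order_trans psd_def)
qed

section \<open>Inverses of positive definite matrices\<close>

lemma sum_matrix_vector_mult: "(\<Sum>i\<in>I. M i) *v x = (\<Sum>i\<in>I. M i *v x)"
  by (induction I rule: infinite_finite_induct) (simp_all add: matrix_vector_mult_add_rdistrib)

lemma inner_congruence: "x \<bullet> ((transpose E ** X ** F) *v u) = (E *v x) \<bullet> (X *v (F *v u))"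
  for E :: "real^'a^'b"
  by (simp add: matrix_vector_mul_assoc[symmetric] inner_transpose_mult)

lemma pd_matrix_inv:
  fixes P :: "real^'n^'n"
  assumes "pd P"
  shows "P ** matrix_inv P = mat 1" "matrix_inv P ** P = mat 1"
proof -
  have "\<forall>x. P *v x = 0 \<longrightarrow> x = 0" using assms by (metis inner_zero_right less_irrefl pd_def)
  then have "invertible P" by (simp add: invertible_left_inverse matrix_left_invertible_ker)
  then have "\<exists>P'. P ** P' = mat 1 \<and> P' ** P = mat 1" by (simp add: invertible_def)
  then have "P ** matrix_inv P = mat 1 \<and> matrix_inv P ** P = mat 1"
    unfolding matrix_inv_def by (rule someI_ex)
  then show "P ** matrix_inv P = mat 1" "matrix_inv P ** P = mat 1" by auto
qed

lemma pd_matrix_inv_cancel: "pd P \<Longrightarrow> P *v (matrix_inv P *v x) = x"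
  by (simp add: matrix_vector_mul_assoc pd_matrix_inv)

lemma sym_mat_matrix_inv:
  assumes "sym_mat P" "pd P"
  shows "sym_mat (matrix_inv P)"
  unfolding sym_mat_iff_inner by (metis assms pd_matrix_inv_cancel sym_mat_inner)

lemma pd_bound:
  fixes P :: "real^'n^'n"
  assumes "pd P"
  obtains c where "0 < c" "\<And>x. c * (norm x)\<^sup>2 \<le> x \<bullet> (P *v x)"
proof -
  have "pd (mat 1 :: real^'n^'n)" by (simp add: pd_def)
  then obtain t x where x: "x \<noteq> 0" "x \<bullet> (P *v x) = t * (x \<bullet> (mat 1 *v x))"
    and t: "\<And>y. t * (y \<bullet> (mat 1 *v y)) \<le> y \<bullet> (P *v y)"
    using pd_rayleigh_min[of "mat 1" P] by metis
  have "0 < t * (x \<bullet> x)" using assms x unfolding pd_def by (metis matrix_vector_mul_lid)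
  then have "0 < t" by (simp add: zero_less_mult_iff inner_ge_zero leD)
  then show ?thesis using that t by (simp add: power2_norm_eq_inner)
qed

lemma complete_square:
  fixes N :: "real^'m^'n" and P :: "real^'m^'m"
  assumes P: "sym_mat P" "pd P"
  defines "g \<equiv> \<lambda>x. - (matrix_inv P *v (transpose N *v x))"
  shows "2 * (x \<bullet> (N *v u)) + u \<bullet> (P *v u)
    = (u - g x) \<bullet> (P *v (u - g x)) - x \<bullet> ((N ** matrix_inv P ** transpose N) *v x)"
proof -
  have Pg: "P *v g x = - (transpose N *v x)"
    by (simp add: g_def matrix_vector_mult_minus_right pd_matrix_inv_cancel[OF P(2)])
  have xN: "x \<bullet> (N *v w) = - (w \<bullet> (P *v g x))" for w
    unfolding Pg by (simp add: inner_transpose_mult inner_commute)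
  have "(N ** matrix_inv P ** transpose N) *v x = - (N *v g x)"
    by (simp add: g_def matrix_vector_mult_minus_right matrix_vector_mul_assoc[symmetric])
  then have "x \<bullet> ((N ** matrix_inv P ** transpose N) *v x) = g x \<bullet> (P *v g x)"
    by (simp add: xN)
  moreover have "g x \<bullet> (P *v u) = u \<bullet> (P *v g x)"
    using sym_mat_inner[OF P(1)] by (metis inner_commute)
  ultimately show ?thesis
    by (simp add: xN matrix_vector_mult_diff_distrib inner_diff_left inner_diff_right)
qed

section \<open>Convergence of matrices\<close>

lemma tendsto_matrix_vector_mult [tendsto_intros]:
  fixes f :: "'a \<Rightarrow> real^'n^'m"
  assumes "(f \<longlongrightarrow> M) F" "(g \<longlongrightarrow> x) F"
  shows "((\<lambda>t. f t *v g t) \<longlongrightarrow> M *v x) F"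
  unfolding matrix_vector_mult_def
  by (intro vec_tendstoI) (simp, intro tendsto_intros assms)

lemma tendsto_matrix_matrix_mult [tendsto_intros]:
  fixes f :: "'a \<Rightarrow> real^'n^'m"
  assumes "(f \<longlongrightarrow> M) F" "(g \<longlongrightarrow> N) F"
  shows "((\<lambda>t. f t ** g t) \<longlongrightarrow> M ** N) F"
  unfolding matrix_matrix_mult_def
  by (intro vec_tendstoI) (simp, intro tendsto_intros assms)

lemma tendsto_transpose [tendsto_intros]:
  fixes f :: "'a \<Rightarrow> real^'n^'m"
  assumes "(f \<longlongrightarrow> M) F"
  shows "((\<lambda>t. transpose (f t)) \<longlongrightarrow> transpose M) F"
  unfolding transpose_def
  by (intro vec_tendstoI) (simp, intro tendsto_intros assms)

lemma loewner_decreasing_convergent: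
  fixes X :: "nat \<Rightarrow> real^'n^'n"
  assumes sym: "\<And>k. sym_mat (X k)" and dec: "\<And>k. loewner_ge (X k) (X (Suc k))"
    and bdd: "\<And>k. loewner_ge (X k) Y"
  obtains Z where "X \<longlonglongrightarrow> Z" "sym_mat Z" "loewner_ge Z Y"
proof -
  define q where "q x k = x \<bullet> (X k *v x)" for x k
  have conv: "convergent (q x)" for x
  proof -
    have "decseq (q x)"
      using dec unfolding q_def decseq_Suc_iff loewner_ge_def psd_def
      by (simp add: matrix_vector_mult_diff_rdistrib inner_diff_right)
    moreover have "x \<bullet> (Y *v x) \<le> q x k" for k
      using bdd unfolding q_def loewner_ge_def psd_def
      by (simp add: matrix_vector_mult_diff_rdistrib inner_diff_right)
    ultimately show ?thesis by (metis decseq_convergent convergentI)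
  qed
  have entry: "X k $ i $ j = (q (axis i 1 + axis j 1) k - q (axis i 1) k - q (axis j 1) k) / 2"
    for k i j
  proof -
    have "axis i 1 \<bullet> (X k *v axis j 1) = X k $ i $ j" for i j
      by (simp add: inner_axis' matrix_vector_mult_basis column_def)
    moreover have "X k $ j $ i = X k $ i $ j"
      using sym[of k] unfolding sym_mat_def by (metis transpose_def vec_lambda_beta)
    ultimately show ?thesis
      by (simp add: q_def matrix_vector_right_distrib inner_add_left inner_add_right)
  qed
  obtain l where l: "\<And>x. q x \<longlonglongrightarrow> l x"
    using conv unfolding convergent_def by metis
  define Z where "Z i j = (l (axis i 1 + axis j 1) - l (axis i 1) - l (axis j 1)) / 2" for i j
  have "(\<lambda>k. X k $ i $ j) \<longlonglongrightarrow> Z i j" for i j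
    unfolding entry Z_def by (intro tendsto_intros l) simp
  then have lim: "X \<longlonglongrightarrow> (\<chi> i j. Z i j)"
    by (intro vec_tendstoI) simp
  have "(\<lambda>k. transpose (X k)) \<longlonglongrightarrow> transpose (\<chi> i j. Z i j)"
    by (intro tendsto_intros lim)
  then have "sym_mat (\<chi> i j. Z i j)"
    using sym lim LIMSEQ_unique unfolding sym_mat_def by auto
  moreover have "loewner_ge (\<chi> i j. Z i j) Y"
    unfolding loewner_ge_def psd_def
  proof
    fix x :: "real^'n"
    have "(\<lambda>k. x \<bullet> ((X k - Y) *v x)) \<longlonglongrightarrow> x \<bullet> (((\<chi> i j. Z i j) - Y) *v x)"
      by (intro tendsto_intros lim)
    then show "0 \<le> x \<bullet> (((\<chi> i j. Z i j) - Y) *v x)"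
      using bdd unfolding loewner_ge_def psd_def by (intro LIMSEQ_le_const) auto
  qed
  ultimately show ?thesis using that lim by blast
qed

lemma tendsto_pd_solve:
  fixes P :: "nat \<Rightarrow> real^'m^'m"
  assumes P: "P \<longlonglongrightarrow> P'" and lb: "0 < c" "\<And>k y. c * (norm y)\<^sup>2 \<le> y \<bullet> (P k *v y)"
    and u: "\<And>k. P k *v u k = b k" and b: "b \<longlonglongrightarrow> P' *v u'"
  shows "u \<longlonglongrightarrow> u'"
proof -
  have bound: "norm (u k - u') \<le> norm (b k - P k *v u') / c" for k
  proof -
    let ?d = "u k - u'"
    have "c * (norm ?d)\<^sup>2 \<le> ?d \<bullet> (P k *v ?d)" by (rule lb)
    also have "\<dots> \<le> norm ?d * norm (P k *v ?d)" by (rule norm_cauchy_schwarz)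
    also have "P k *v ?d = b k - P k *v u'" by (simp add: matrix_vector_mult_diff_distrib u)
    finally have "norm ?d * (c * norm ?d) \<le> norm ?d * norm (b k - P k *v u')"
      by (simp add: power2_eq_square mult_ac)
    then have "c * norm ?d \<le> norm (b k - P k *v u')"
      by (cases "?d = 0") simp_all
    then show ?thesis using lb(1) by (simp add: field_simps)
  qed
  have "(\<lambda>k. norm (b k - P k *v u') / c) \<longlonglongrightarrow> norm (P' *v u' - P' *v u') / c"
    using lb(1) by (intro tendsto_intros P b) simp
  then have "(\<lambda>k. norm (b k - P k *v u') / c) \<longlonglongrightarrow> 0" by simp
  then have "(\<lambda>k. u k - u') \<longlonglongrightarrow> 0"
    by (rule Lim_null_comparison[rotated]) (simp add: bound)
  then show ?thesis by (simp add: LIM_zero_iff)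
qed

section \<open>The Riccati operator as a minimum\<close>

locale riccati_data =
  fixes A Q :: "real^'n^'n" and B L :: "real^'m^'n" and R :: "real^'m^'m"
    and r :: nat and A0 :: "nat \<Rightarrow> real^'n^'n" and B0 :: "nat \<Rightarrow> real^'m^'n"
  assumes symQ: "sym_mat Q" and symR: "sym_mat R" and pdR: "pd R"
    and block: "\<And>x u. 0 \<le> x \<bullet> (Q *v x) + 2 * (x \<bullet> (L *v u)) + u \<bullet> (R *v u)"
begin

definition stage :: "real^'n \<Rightarrow> real^'m \<Rightarrow> real" where
  "stage x u = x \<bullet> (Q *v x) + 2 * (x \<bullet> (L *v u)) + u \<bullet> (R *v u)"

definition noise :: "real^'n^'n \<Rightarrow> real^'n \<Rightarrow> real^'m \<Rightarrow> real" where
  "noise X x u = (\<Sum>i=1..r. (A0 i *v x + B0 i *v u) \<bullet> (X *v (A0 i *v x + B0 i *v u)))"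

definition ham :: "real^'n^'n \<Rightarrow> real^'n^'n \<Rightarrow> real^'n \<Rightarrow> real^'m \<Rightarrow> real" where
  "ham X Y x u = 2 * ((Y *v x) \<bullet> (A *v x + B *v u)) + stage x u + noise X x u"

definition gain :: "real^'n^'n \<Rightarrow> real^'n^'n \<Rightarrow> real^'n \<Rightarrow> real^'m" where
  "gain X Y x = - (matrix_inv (Rc R r B0 X) *v (transpose (Y ** B + Lc L r A0 B0 X) *v x))"

definition residual :: "real^'n^'n \<Rightarrow> real^'n^'n \<Rightarrow> real^'n^'n" where
  "residual X Y = transpose A ** Y + Y ** A + Qc Q r A0 X
    - (Y ** B + Lc L r A0 B0 X) ** matrix_inv (Rc R r B0 X) ** transpose (Y ** B + Lc L r A0 B0 X)"

lemma Ric_eq_residual: "Ric A B Q L R r A0 B0 X = residual X X"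
  by (simp add: Ric_def residual_def Qc_def Lc_def Rc_def add.assoc)

lemma stage_nonneg: "0 \<le> stage x u"
  using block by (simp add: stage_def)

lemma noise_mono: "loewner_ge X X' \<Longrightarrow> noise X' x u \<le> noise X x u"
  unfolding noise_def loewner_ge_def psd_def
  by (intro sum_mono) (simp add: matrix_vector_mult_diff_rdistrib inner_diff_right)

lemma noise_nonneg: "psd X \<Longrightarrow> 0 \<le> noise X x u"
  unfolding noise_def psd_def by (intro sum_nonneg) simp

lemma Qc_form: "x \<bullet> (Qc Q r A0 X *v y) = x \<bullet> (Q *v y) + (\<Sum>i=1..r. (A0 i *v x) \<bullet> (X *v (A0 i *v y)))"
  by (simp add: Qc_def Pi11_def matrix_vector_mult_add_rdistrib sum_matrix_vector_mult
      inner_add_right inner_sum_right inner_congruence)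

lemma Lc_form: "x \<bullet> (Lc L r A0 B0 X *v u) = x \<bullet> (L *v u) + (\<Sum>i=1..r. (A0 i *v x) \<bullet> (X *v (B0 i *v u)))"
  by (simp add: Lc_def Pi12_def matrix_vector_mult_add_rdistrib sum_matrix_vector_mult
      inner_add_right inner_sum_right inner_congruence)

lemma Rc_form: "u \<bullet> (Rc R r B0 X *v w) = u \<bullet> (R *v w) + (\<Sum>i=1..r. (B0 i *v u) \<bullet> (X *v (B0 i *v w)))"
  by (simp add: Rc_def Pi22_def matrix_vector_mult_add_rdistrib sum_matrix_vector_mult
      inner_add_right inner_sum_right inner_congruence)

lemma Qc_sym: "sym_mat X \<Longrightarrow> sym_mat (Qc Q r A0 X)"
  unfolding sym_mat_iff_inner
  by (simp add: inner_commute[of "Qc Q r A0 X *v _"] Qc_form)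
    (metis (no_types, lifting) inner_commute sum.cong sym_mat_inner symQ sym_mat_iff_inner)

lemma Rc_sym: "sym_mat X \<Longrightarrow> sym_mat (Rc R r B0 X)"
  unfolding sym_mat_iff_inner
  by (simp add: inner_commute[of "Rc R r B0 X *v _"] Rc_form)
    (metis (no_types, lifting) inner_commute sum.cong sym_mat_inner symR sym_mat_iff_inner)

lemma Rc_ge: "psd X \<Longrightarrow> u \<bullet> (R *v u) \<le> u \<bullet> (Rc R r B0 X *v u)"
  unfolding Rc_form psd_def by (simp add: sum_nonneg)

lemma Rc_pd: "psd X \<Longrightarrow> pd (Rc R r B0 X)"
  using Rc_ge pdR unfolding pd_def by (meson less_le_trans)

lemma stage_noise_eq:
  assumes "sym_mat X"
  shows "stage x u + noise X x u = x \<bullet> (Qc Q r A0 X *v x)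
      + 2 * (x \<bullet> (Lc L r A0 B0 X *v u)) + u \<bullet> (Rc R r B0 X *v u)"
proof -
  have "(a + b) \<bullet> (X *v (a + b)) = a \<bullet> (X *v a) + 2 * (a \<bullet> (X *v b)) + b \<bullet> (X *v b)" for a b
    using sym_mat_inner[OF assms, of b a]
    by (simp add: matrix_vector_right_distrib inner_add_left inner_add_right inner_commute)
  then have "noise X x u = (\<Sum>i=1..r. (A0 i *v x) \<bullet> (X *v (A0 i *v x)))
      + 2 * (\<Sum>i=1..r. (A0 i *v x) \<bullet> (X *v (B0 i *v u)))
      + (\<Sum>i=1..r. (B0 i *v u) \<bullet> (X *v (B0 i *v u)))"
    by (simp add: noise_def sum.distrib sum_distrib_left)
  then show ?thesis by (simp add: stage_def Qc_form Lc_form Rc_form)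
qed

lemma ham_eq:
  assumes X: "sym_mat X" "psd X" and Y: "sym_mat Y"
  shows "ham X Y x u = x \<bullet> (residual X Y *v x)
    + (u - gain X Y x) \<bullet> (Rc R r B0 X *v (u - gain X Y x))"
proof -
  let ?N = "Y ** B + Lc L r A0 B0 X"
  have "ham X Y x u = 2 * ((Y *v x) \<bullet> (A *v x)) + x \<bullet> (Qc Q r A0 X *v x)
      + (2 * (x \<bullet> (?N *v u)) + u \<bullet> (Rc R r B0 X *v u))"
    unfolding ham_def add.assoc stage_noise_eq[OF X(1)]
    by (simp add: inner_add_right matrix_vector_mult_add_rdistrib
        matrix_vector_mul_assoc[symmetric] sym_mat_inner[OF Y])
  also have "2 * (x \<bullet> (?N *v u)) + u \<bullet> (Rc R r B0 X *v u)
      = (u - gain X Y x) \<bullet> (Rc R r B0 X *v (u - gain X Y x))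
        - x \<bullet> ((?N ** matrix_inv (Rc R r B0 X) ** transpose ?N) *v x)"
    unfolding gain_def by (rule complete_square[OF Rc_sym[OF X(1)] Rc_pd[OF X(2)]])
  also have "2 * ((Y *v x) \<bullet> (A *v x)) = x \<bullet> ((transpose A ** Y + Y ** A) *v x)"
    by (simp add: lyapunov_form[OF Y])
  finally show ?thesis
    unfolding residual_def matrix_vector_mult_diff_rdistrib[of _ _ x] inner_diff_right
      matrix_vector_mult_add_rdistrib[of _ "Qc Q r A0 X" x] inner_add_right by simp
qed

lemma residual_le_ham:
  assumes "sym_mat X" "psd X" "sym_mat Y"
  shows "x \<bullet> (residual X Y *v x) \<le> ham X Y x u"
  unfolding ham_eq[OF assms] using Rc_pd[OF assms(2)]
  by (metis add.commute add_le_cancel_right inner_zero_left le_add_same_cancel2 less_eq_real_def pd_def)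

lemma residual_eq_ham:
  assumes "sym_mat X" "psd X" "sym_mat Y"
  shows "x \<bullet> (residual X Y *v x) = ham X Y x (gain X Y x)"
  unfolding ham_eq[OF assms] by simp

lemma residual_mono:
  assumes "sym_mat X" "psd X" "sym_mat X'" "psd X'" "sym_mat Y" "loewner_ge X X'"
  shows "x \<bullet> (residual X' Y *v x) \<le> x \<bullet> (residual X Y *v x)"
proof -
  have "x \<bullet> (residual X' Y *v x) \<le> ham X' Y x (gain X Y x)"
    by (rule residual_le_ham) fact+
  also have "\<dots> \<le> ham X Y x (gain X Y x)" by (simp add: ham_def noise_mono assms)
  also have "\<dots> = x \<bullet> (residual X Y *v x)" by (rule residual_eq_ham[symmetric]) fact+
  finally show ?thesis .
qed

lemma residual_sym:
  assumes "sym_mat X" "psd X" "sym_mat Y"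
  shows "sym_mat (residual X Y)"
proof -
  have "transpose (matrix_inv (Rc R r B0 X)) = matrix_inv (Rc R r B0 X)"
    using sym_mat_matrix_inv[OF Rc_sym[OF assms(1)] Rc_pd[OF assms(2)]] by (simp add: sym_mat_def)
  then show ?thesis
    using assms(3) Qc_sym[OF assms(1)]
    by (simp add: sym_mat_def residual_def transpose_add transpose_diff matrix_transpose_mul
        matrix_mul_assoc)
qed

lemma care_eq_residual:
  assumes "sym_mat X" "psd X" "sym_mat Y"
  shows "transpose (Ac A B L R r A0 B0 X) ** Y + Y ** Ac A B L R r A0 B0 X
       - Y ** Gc B R r B0 X ** Y + Hc Q L R r A0 B0 X = residual X Y"
proof -
  define I l where "I = matrix_inv (Rc R r B0 X)" and "l = Lc L r A0 B0 X"
  have I: "transpose I = I"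
    using sym_mat_matrix_inv[OF Rc_sym[OF assms(1)] Rc_pd[OF assms(2)]] by (simp add: I_def sym_mat_def)
  have Y: "transpose Y = Y" using assms(3) by (simp add: sym_mat_def)
  have tA: "transpose (A - B ** I ** transpose l) = transpose A - l ** I ** transpose B"
    using I by (simp add: transpose_diff matrix_transpose_mul matrix_mul_assoc)
  show ?thesis
    unfolding matrix_eq residual_def Ac_def Gc_def Hc_def I_def[symmetric] l_def[symmetric] tA
    by (simp add: transpose_add matrix_transpose_mul Y matrix_vector_mul_assoc[symmetric]
        matrix_vector_mult_add_rdistrib matrix_vector_mult_diff_rdistrib
        matrix_vector_right_distrib matrix_vector_mult_diff_distrib)
qed

lemma closed_loop_eq:
  assumes "sym_mat Y"
  shows "(Ac A B L R r A0 B0 X - Gc B R r B0 X ** Y) *v x = A *v x + B *v gain X Y x"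
proof -
  have Y: "transpose Y = Y" using assms by (simp add: sym_mat_def)
  show ?thesis
    by (simp add: Ac_def Gc_def gain_def matrix_vector_mult_minus_right transpose_add
        matrix_transpose_mul Y matrix_vector_mul_assoc[symmetric] matrix_vector_mult_add_rdistrib
        matrix_vector_mult_diff_rdistrib matrix_vector_right_distrib
        matrix_vector_mult_diff_distrib)
qed

lemma stage_eq_0D:
  assumes "stage x u = 0"
  shows "(Q - L ** matrix_inv R ** transpose L) *v x = 0"
    and "u = - (matrix_inv R *v (transpose L *v x))"
proof -
  let ?H = "Q - L ** matrix_inv R ** transpose L"
  let ?g = "\<lambda>x. - (matrix_inv R *v (transpose L *v x))"
  have stage_eq: "stage x u = x \<bullet> (?H *v x) + (u - ?g x) \<bullet> (R *v (u - ?g x))" for x u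
    using complete_square[OF symR pdR, of x L u]
    by (simp add: stage_def matrix_vector_mult_diff_rdistrib inner_diff_right)
  have "transpose (matrix_inv R) = matrix_inv R"
    using sym_mat_matrix_inv[OF symR pdR] by (simp add: sym_mat_def)
  then have "sym_mat ?H"
    using symQ by (simp add: sym_mat_def transpose_diff matrix_transpose_mul matrix_mul_assoc)
  have "psd ?H"
    unfolding psd_def using stage_nonneg stage_eq[of _ "?g _"]
    by (metis add_0_right cancel_comm_monoid_add_class.diff_cancel inner_zero_left)
  then have H: "0 \<le> x \<bullet> (?H *v x)" by (simp add: psd_def)
  have "0 \<le> (u - ?g x) \<bullet> (R *v (u - ?g x))"
    using pdR by (metis inner_zero_left less_eq_real_def pd_def)
  then have *: "x \<bullet> (?H *v x) = 0" "(u - ?g x) \<bullet> (R *v (u - ?g x)) = 0"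
    using H assms unfolding stage_eq by linarith+
  show "?H *v x = 0" by (rule psd_kernel) fact+
  show "u = ?g x" using *(2) pdR by (metis eq_iff_diff_eq_0 less_irrefl pd_def)
qed

lemma closed_loop_stable:
  assumes X: "sym_mat X" "psd X" and Ric: "\<And>x. x \<bullet> (residual X X *v x) \<le> 0"
    and A4: "\<And>x. (Q - L ** matrix_inv R ** transpose L) *v x = 0 \<Longrightarrow> transpose L *v x = 0"
    and det: "stable (A + K ** (Q - L ** matrix_inv R ** transpose L))"
  shows "stable (Ac A B L R r A0 B0 X - Gc B R r B0 X ** X)" (is "stable ?M")
  unfolding stable_iff_real
proof (intro allI impI, elim conjE)
  fix \<alpha> \<beta> a b
  assume ab: "a \<noteq> 0 \<or> b \<noteq> 0" and Ma: "?M *v a = \<alpha> *\<^sub>R a - \<beta> *\<^sub>R b"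
    and Mb: "?M *v b = \<beta> *\<^sub>R a + \<alpha> *\<^sub>R b"
  let ?H = "Q - L ** matrix_inv R ** transpose L"
  let ?g = "gain X X"
  show "\<alpha> < 0"
  proof (rule ccontr)
    assume "\<not> \<alpha> < 0"
    have le: "2 * ((X *v x) \<bullet> (?M *v x)) + stage x (?g x) \<le> 0" for x
      using Ric[of x] noise_nonneg[OF X(2), of x "?g x"]
      unfolding residual_eq_ham[OF X X(1)] ham_def closed_loop_eq[OF X(1)] by linarith
    have "(X *v a) \<bullet> b = (X *v b) \<bullet> a" by (metis X(1) inner_commute sym_mat_inner)
    then have "(X *v a) \<bullet> (?M *v a) + (X *v b) \<bullet> (?M *v b)
        = \<alpha> * (a \<bullet> (X *v a) + b \<bullet> (X *v b))"
      unfolding Ma Mb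
      by (simp add: inner_diff_right inner_add_right inner_commute algebra_simps)
    moreover have "0 \<le> \<alpha> * (a \<bullet> (X *v a) + b \<bullet> (X *v b))"
      using \<open>\<not> \<alpha> < 0\<close> X(2) by (simp add: psd_def)
    ultimately have stage0: "stage a (?g a) = 0" "stage b (?g b) = 0"
      using le[of a] le[of b] stage_nonneg[of a "?g a"] stage_nonneg[of b "?g b"] by linarith+
    have "(A + K ** ?H) *v x = ?M *v x" if "stage x (?g x) = 0" for x
    proof -
      have H: "?H *v x = 0" using stage_eq_0D(1)[OF that] .
      have "?g x = 0" using stage_eq_0D(2)[OF that] A4[OF H] by simp
      then show ?thesis
        unfolding closed_loop_eq[OF X(1)]
        by (simp add: matrix_vector_mult_add_rdistrib matrix_vector_mul_assoc[symmetric] H)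
    qed
    then have "\<alpha> < 0"
      using det ab Ma Mb stage0 unfolding stable_iff_real by metis
    then show False using \<open>\<not> \<alpha> < 0\<close> by simp
  qed
qed

lemma residual_comparison:
  assumes X: "sym_mat X" "psd X" and Y: "sym_mat Y" and Z: "sym_mat Z"
    and M: "stable (Ac A B L R r A0 B0 X - Gc B R r B0 X ** Y)"
    and le: "\<And>x. x \<bullet> (residual X Y *v x) \<le> x \<bullet> (residual X Z *v x)"
  shows "loewner_ge Y Z"
  unfolding loewner_ge_def
proof (rule lyapunov_comparison[OF M])
  show "sym_mat (Y - Z)" using Y Z by (simp add: sym_mat_def transpose_diff)
  fix x
  have "ham X Y x (gain X Y x) \<le> ham X Z x (gain X Y x)"
    using residual_eq_ham[OF X Y, of x] le[of x] residual_le_ham[OF X Z, of x "gain X Y x"]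
    by linarith
  then show "((Y - Z) *v x) \<bullet> ((Ac A B L R r A0 B0 X - Gc B R r B0 X ** Y) *v x) \<le> 0"
    unfolding ham_def closed_loop_eq[OF Y]
    by (simp add: matrix_vector_mult_diff_rdistrib inner_diff_left)
qed

lemma residual_form_tendsto:
  assumes X: "X \<longlonglongrightarrow> X'" "\<And>k. sym_mat (X k)" "\<And>k. psd (X k)" "sym_mat X'" "psd X'"
    and Y: "Y \<longlonglongrightarrow> Y'" "\<And>k. sym_mat (Y k)" "sym_mat Y'"
  shows "(\<lambda>k. x \<bullet> (residual (X k) (Y k) *v x)) \<longlonglongrightarrow> x \<bullet> (residual X' Y' *v x)"
proof -
  obtain c where c: "0 < c" "\<And>u. c * (norm u)\<^sup>2 \<le> u \<bullet> (R *v u)" using pd_bound[OF pdR] by blast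
  have Rg: "Rc R r B0 X *v gain X Y x = - (transpose (Y ** B + Lc L r A0 B0 X) *v x)"
    if "psd X" for X Y
    by (simp add: gain_def matrix_vector_mult_minus_right pd_matrix_inv_cancel[OF Rc_pd[OF that]])
  have u: "(\<lambda>k. gain (X k) (Y k) x) \<longlonglongrightarrow> gain X' Y' x"
  proof (rule tendsto_pd_solve[OF _ c(1) _ Rg[OF X(3)]])
    show "(\<lambda>k. Rc R r B0 (X k)) \<longlonglongrightarrow> Rc R r B0 X'"
      unfolding Rc_def Pi22_def by (intro tendsto_intros X(1))
    show "c * (norm y)\<^sup>2 \<le> y \<bullet> (Rc R r B0 (X k) *v y)" for k y
      using c(2) Rc_ge[OF X(3)] by (rule order_trans)
    show "(\<lambda>k. - (transpose (Y k ** B + Lc L r A0 B0 (X k)) *v x)) \<longlonglongrightarrow> Rc R r B0 X' *v gain X' Y' x"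
      unfolding Rg[OF X(5)] Lc_def Pi12_def by (intro tendsto_intros X(1) Y(1))
  qed
  show ?thesis
    unfolding residual_eq_ham[OF X(2,3) Y(2)] residual_eq_ham[OF X(4,5) Y(3)] ham_def stage_def noise_def
    by (intro tendsto_intros X(1) Y(1) u)
qed

end

theorem theorem3p4:
  fixes A Q :: "real^'n^'n" and B L :: "real^'m^'n" and R :: "real^'m^'m"
    and r :: nat and A0 :: "nat \<Rightarrow> real^'n^'n" and B0 :: "nat \<Rightarrow> real^'m^'n"
    and Xs :: "real^'n^'n" and X :: "nat \<Rightarrow> real^'n^'n"
  assumes symQ: "sym_mat Q" and symR: "sym_mat R"
    and A1_R: "pd R"
    and A1_block: "\<forall>x u. 0 \<le> x \<bullet> (Q *v x) + 2 * (x \<bullet> (L *v u)) + u \<bullet> (R *v u)"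
    and A2: "\<exists>F :: real^'n^'m. exp_stable (\<lambda>S.
               (A + B ** F) ** S + S ** transpose (A + B ** F)
               + (\<Sum>i=1..r. (A0 i + B0 i ** F) ** S ** transpose (A0 i + B0 i ** F)))"
    and A3: "\<exists>C :: real^'n^'p. transpose C ** C = Q - L ** matrix_inv R ** transpose L \<and>
             (\<exists>K :: real^'p^'n. exp_stable (\<lambda>S.
               ((A - B ** matrix_inv R ** transpose L) + K ** C) ** S
               + S ** transpose ((A - B ** matrix_inv R ** transpose L) + K ** C)
               + (\<Sum>i=1..r. (A0 i - B0 i ** matrix_inv R ** transpose L) ** S
                              ** transpose (A0 i - B0 i ** matrix_inv R ** transpose L))))"
    and A4: "\<forall>x. (Q - L ** matrix_inv R ** transpose L) *v x = 0 \<longrightarrow>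
               transpose L *v x = 0 \<and> (\<forall>i\<in>{1..r}. A0 i *v x = 0)"
    and A5_stab: "\<exists>F :: real^'n^'m. stable (A + B ** F)"
    and A5_det: "\<exists>K :: real^'n^'n. stable (A + K ** (Q - L ** matrix_inv R ** transpose L))"
    and Xs_sym: "sym_mat Xs" and Xs_psd: "psd Xs"
    and Xs_sol: "Ric A B Q L R r A0 B0 Xs = 0"
    and Xs_unique: "\<forall>Y. sym_mat Y \<and> psd Y \<and> Ric A B Q L R r A0 B0 Y = 0 \<longrightarrow> Y = Xs"
    and X0_sym: "sym_mat (X 0)"
    and X0_ge: "loewner_ge (X 0) Xs"
    and X0_stab: "stable (Ac A B L R r A0 B0 (X 0) - Gc B R r B0 (X 0) ** X 0)"
    and X0_Ric: "loewner_ge 0 (Ric A B Q L R r A0 B0 (X 0))"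
    and step: "\<forall>k. sym_mat (X (Suc k)) \<and>
       transpose (Ac A B L R r A0 B0 (X k)) ** X (Suc k) + X (Suc k) ** Ac A B L R r A0 B0 (X k)
       - X (Suc k) ** Gc B R r B0 (X k) ** X (Suc k) + Hc Q L R r A0 B0 (X k) = 0 \<and>
       stable (Ac A B L R r A0 B0 (X k) - Gc B R r B0 (X k) ** X (Suc k))"
  shows "(\<forall>k. loewner_ge (X k) (X (Suc k)) \<and> loewner_ge (X k) Xs
              \<and> loewner_ge 0 (Ric A B Q L R r A0 B0 (X k)))
         \<and> X \<longlonglongrightarrow> Xs"
proof -
  interpret riccati_data A Q B L R r A0 B0
    using symQ symR A1_R A1_block by unfold_locales auto
  have sym: "sym_mat (X k)" for k using X0_sym step by (cases k) auto
  have Ric_iff: "loewner_ge 0 (Ric A B Q L R r A0 B0 Y) \<longleftrightarrow> (\<forall>x. x \<bullet> (residual Y Y *v x) \<le> 0)" for Y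
    by (simp add: loewner_ge_def psd_def Ric_eq_residual matrix_vector_mult_minus_left)
  have res_Xs: "residual Xs Xs = 0" using Xs_sol by (simp add: Ric_eq_residual)
  have psd_ge: "psd Y" if "loewner_ge Y Xs" for Y using that Xs_psd by (rule psd_if_loewner_ge)
  have res_Suc: "residual (X k) (X (Suc k)) = 0" if "loewner_ge (X k) Xs" for k
    using step care_eq_residual[OF sym psd_ge[OF that] sym] by metis
  have invariant: "loewner_ge (X k) Xs \<and> loewner_ge 0 (Ric A B Q L R r A0 B0 (X k))
      \<and> stable (Ac A B L R r A0 B0 (X k) - Gc B R r B0 (X k) ** X k)
      \<and> loewner_ge (X k) (X (Suc k))" for k
  proof -
    have dec: "loewner_ge (X k) (X (Suc k))"
      if ge: "loewner_ge (X k) Xs" and Ric: "loewner_ge 0 (Ric A B Q L R r A0 B0 (X k))"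
        and st: "stable (Ac A B L R r A0 B0 (X k) - Gc B R r B0 (X k) ** X k)" for k
      using Ric unfolding Ric_iff
      by (intro residual_comparison[OF sym psd_ge[OF ge] sym sym st]) (simp add: res_Suc[OF ge])
    show ?thesis
    proof (induction k)
      case 0
      then show ?case using X0_ge X0_Ric X0_stab dec by blast
    next
      case (Suc k)
      then have ge: "loewner_ge (X k) Xs" and dec_k: "loewner_ge (X k) (X (Suc k))" by auto
      note psd_k = psd_ge[OF ge]
      have ge': "loewner_ge (X (Suc k)) Xs"
      proof (rule residual_comparison[OF sym psd_k sym Xs_sym])
        show "stable (Ac A B L R r A0 B0 (X k) - Gc B R r B0 (X k) ** X (Suc k))" using step by blast
        show "x \<bullet> (residual (X k) (X (Suc k)) *v x) \<le> x \<bullet> (residual (X k) Xs *v x)" for x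
          using residual_mono[OF sym psd_k Xs_sym Xs_psd Xs_sym ge, of x]
          by (simp add: res_Suc[OF ge] res_Xs)
      qed
      note psd_Suc = psd_ge[OF ge']
      have Ric': "x \<bullet> (residual (X (Suc k)) (X (Suc k)) *v x) \<le> 0" for x
        using residual_mono[OF sym psd_k sym psd_Suc sym[of "Suc k"] dec_k, of x] by (simp add: res_Suc[OF ge])
      obtain K :: "real^'n^'n" where K: "stable (A + K ** (Q - L ** matrix_inv R ** transpose L))"
        using A5_det by blast
      have st': "stable (Ac A B L R r A0 B0 (X (Suc k)) - Gc B R r B0 (X (Suc k)) ** X (Suc k))"
        using A4 by (intro closed_loop_stable[OF sym psd_Suc Ric' _ K]) blast
      show ?case using ge' Ric' st' dec Ric_iff by blast
    qed
  qed
  obtain Z where Z: "X \<longlonglongrightarrow> Z" "sym_mat Z" "loewner_ge Z Xs"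
    using loewner_decreasing_convergent[of X Xs] sym invariant by blast
  note psd_Z = psd_ge[OF Z(3)]
  have psd_X: "psd (X k)" for k using invariant psd_ge by blast
  have "x \<bullet> (residual Z Z *v x) = 0" for x
  proof (rule LIMSEQ_unique)
    show "(\<lambda>k. x \<bullet> (residual (X k) (X (Suc k)) *v x)) \<longlonglongrightarrow> x \<bullet> (residual Z Z *v x)"
      by (intro residual_form_tendsto Z LIMSEQ_Suc sym psd_X psd_Z)
    show "(\<lambda>k. x \<bullet> (residual (X k) (X (Suc k)) *v x)) \<longlonglongrightarrow> 0"
      using res_Suc invariant by simp
  qed
  then have "residual Z Z = 0" by (intro sym_mat_eq_0 residual_sym Z psd_Z)
  then have "Z = Xs" using Xs_unique Z(2) psd_Z by (simp add: Ric_eq_residual)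
  then show ?thesis using invariant Z(1) by blast
qed

end
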